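(* Let $V$ be a function analytic in a neighborhood of $0$ in $\mathbf{C}$ with $V(0)=0$ and $V'(0)=1$. Let $W(z)=1/V'(z)$ near $0$, and let $U$ be the local inverse function of $V$ near $0$, so that $V(U(v))=v$, $U(V(z))=z$ and $U(0)=0$. Let $Y=X\,W(D)$, acting on polynomials in $x$, and let $\tilde Y=W(A)\,\partial_A$, acting on functions of $A$ analytic near $A=0$. Then for all integers $m,n\ge 0$, the coefficient of $x^m/m!$ in the polynomial $Y^n 1$ is equal to $\tilde Y^n A^m\bigr|_{A=0}$, and each of these equals the coefficient of $v^n/n!$ in the power series expansion about $v=0$ of $U(v)^m$.
   Context: On polynomials in the variable $x$ (with complex coefficients), $D=\frac{d}{dx}$ and $X$ is the operator of multiplication by $x$. If $W(z)=\sum_{k\ge0} w_k z^k$ is the Taylor expansion of $W$ at $0$, then $W(D)=\sum_{k\ge 0} w_k D^k$, which is well defined on polynomials since only finitely many terms act nontrivially on any given polynomial. The operator $Y=XW(D)$ means: first apply $W(D)$, then multiply by $x$. $Y^n1$ denotes the $n$-fold application of $Y$ to the constant polynomial $1$. The variable $A$ is independent of $x$, $\partial_A$ is differentiation with respect to $A$, and $\tilde Y f(A)=W(A)f'(A)$; $\tilde Y^nA^m\bigr|_{A=0}$ means apply $\tilde Y$ $n$ times to the function $A\mapsto A^m$ and then evaluate at $A=0$. The coefficient of $x^m/m!$ in a polynomial $p(x)=\sum_j c_j x^j$ is $m!\,c_m$, and the coefficient of $v^n/n!$ in a power series $\sum_j b_j v^j$ is $n!\,b_n$. *)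

theory Defs
  imports "HOL-Complex_Analysis.Complex_Analysis"
begin

text \<open>
  The series \<open>W(D) = (\<Sum>k. w\<^sub>k D\<^sup>k)\<close> applied to a polynomial \<open>p\<close>, where \<open>w\<^sub>k\<close> are the Taylor
  coefficients of \<open>W\<close> at 0. Terms with \<open>k > degree p\<close> vanish, so the series is truncated there.
\<close>
definition series_D :: "(complex \<Rightarrow> complex) \<Rightarrow> complex poly \<Rightarrow> complex poly" where
  "series_D W p = (\<Sum>k\<le>degree p. smult (fps_nth (fps_expansion W 0) k) ((pderiv ^^ k) p))"

lemma series_D_eq_sum:
  assumes "degree p \<le> N"
  shows "series_D W p = (\<Sum>k\<le>N. smult (fps_nth (fps_expansion W 0) k) ((pderiv ^^ k) p))"
  unfolding series_D_def
proof (rule sum.mono_neutral_left)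
  have "(pderiv ^^ k) p = 0" if "k > degree p" for k
    using that by (intro poly_eqI) (simp add: coeff_higher_pderiv coeff_eq_0)
  then show "\<forall>k\<in>{..N} - {..degree p}. smult (fps_nth (fps_expansion W 0) k) ((pderiv ^^ k) p) = 0"
    by auto
qed (use assms in auto)

definition Y_op :: "(complex \<Rightarrow> complex) \<Rightarrow> complex poly \<Rightarrow> complex poly" where
  "Y_op W p = [:0, 1:] * series_D W p"

text \<open>
  Defined on total functions, but the germ at 0 of the result depends
  only on the germs of \<open>W\<close> and \<open>f\<close>, so iterating and evaluating at 0 is meaningful for germs.
\<close>
definition Y_tilde :: "(complex \<Rightarrow> complex) \<Rightarrow> (complex \<Rightarrow> complex) \<Rightarrow> complex \<Rightarrow> complex" where
  "Y_tilde W f = (\<lambda>A. W A * deriv f A)"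

end

theory Submission
  imports Defs
begin

text \<open>
  Both equalities come from recognising the operators as conjugates of simpler ones.

  For the first, pair a polynomial \<open>p\<close> with a power series \<open>F\<close> by letting \<open>p(D)\<close> act on \<open>F\<close>
  and taking the constant term. Under this pairing \<open>D\<close> on polynomials is adjoint to
  multiplication by the variable on power series, and multiplication by \<open>x\<close> is adjoint to
  differentiation. Hence \<open>Y = X W(D)\<close> is adjoint to \<open>F \<mapsto> W \<cdot> F'\<close>, which is what
  \<open>Y_tilde W\<close> does to Taylor series (lemma \<open>umbral_pairing_Y_op_funpow\<close>). Pairing \<open>Y\<^sup>n 1\<close>
  with \<open>A\<^sup>m\<close> gives \<open>m!\<close> times the coefficient of \<open>x\<^sup>m\<close>; moving \<open>Y\<^sup>n\<close> to the other side
  leaves the pairing of \<open>1\<close> with the series of \<open>Y_tilde\<^sup>n A\<^sup>m\<close>, which is its value at 0.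

  For the second, \<open>U' = 1 / V'(U) = W(U)\<close> (lemma \<open>eventually_deriv_local_inverse\<close>), so \<open>U\<close>
  straightens the vector field \<open>W(A) d/dA\<close> into \<open>d/dv\<close>: by the chain rule
  \<open>(f \<circ> U)' = (Y_tilde W f) \<circ> U\<close>. The \<open>n\<close>-th derivative of \<open>U\<^sup>m\<close> at 0 is therefore the value
  of \<open>Y_tilde\<^sup>n A\<^sup>m\<close> at \<open>U 0 = 0\<close>.
\<close>

text \<open>The constant term of \<open>p(D) F\<close>, since \<open>D\<^sup>j F\<close> has constant term \<open>j! F\<^sub>j\<close>.\<close>
definition umbral_pairing :: "complex poly \<Rightarrow> complex fps \<Rightarrow> complex" where
  "umbral_pairing p F = (\<Sum>j\<le>degree p. coeff p j * fact j * fps_nth F j)"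

lemma umbral_pairing_eq_sum:
  assumes "degree p \<le> N"
  shows "umbral_pairing p F = (\<Sum>j\<le>N. coeff p j * fact j * fps_nth F j)"
  unfolding umbral_pairing_def
  by (rule sum.mono_neutral_left) (use assms in \<open>auto simp: coeff_eq_0\<close>)

lemma umbral_pairing_1_left: "umbral_pairing 1 F = fps_nth F 0"
  by (simp add: umbral_pairing_def)

lemma umbral_pairing_fps_X_power: "umbral_pairing p (fps_X ^ m) = fact m * coeff p m"
proof -
  have "umbral_pairing p (fps_X ^ m)
      = (\<Sum>j\<le>max (degree p) m. coeff p j * fact j * fps_nth (fps_X ^ m) j)"
    by (rule umbral_pairing_eq_sum) simp
  also have "\<dots> = (\<Sum>j\<le>max (degree p) m. if j = m then fact m * coeff p m else 0)"
    by (intro sum.cong) (auto simp: fps_X_power_nth)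
  also have "\<dots> = fact m * coeff p m"
    by simp
  finally show ?thesis .
qed

lemma umbral_pairing_add_left:
  "umbral_pairing (p + q) F = umbral_pairing p F + umbral_pairing q F"
proof -
  let ?N = "max (degree p) (degree q)"
  have "degree (p + q) \<le> ?N"
    by (rule degree_add_le) auto
  then show ?thesis
    by (simp add: umbral_pairing_eq_sum[of _ ?N] sum.distrib distrib_right)
qed

lemma umbral_pairing_smult_left: "umbral_pairing (smult c p) F = c * umbral_pairing p F"
  by (simp add: umbral_pairing_eq_sum[of _ "degree p"] sum_distrib_left mult.assoc)

lemma umbral_pairing_0_left: "umbral_pairing 0 F = 0"
  by (simp add: umbral_pairing_def)

lemma umbral_pairing_sum_left:
  "umbral_pairing (\<Sum>i\<in>I. p i) F = (\<Sum>i\<in>I. umbral_pairing (p i) F)"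
  by (induction I rule: infinite_finite_induct)
     (simp_all add: umbral_pairing_add_left umbral_pairing_0_left)

lemma umbral_pairing_pderiv: "umbral_pairing (pderiv p) F = umbral_pairing p (fps_X * F)"
proof -
  have "umbral_pairing p (fps_X * F)
      = (\<Sum>j\<le>Suc (degree p). coeff p j * fact j * fps_nth (fps_X * F) j)"
    by (rule umbral_pairing_eq_sum) simp
  also have "\<dots> = (\<Sum>j\<le>degree p. coeff p (Suc j) * fact (Suc j) * fps_nth F j)"
    by (subst sum.atMost_Suc_shift) simp
  also have "\<dots> = (\<Sum>j\<le>degree p. coeff (pderiv p) j * fact j * fps_nth F j)"
    by (simp add: coeff_pderiv algebra_simps)
  also have "\<dots> = umbral_pairing (pderiv p) F"
    by (rule umbral_pairing_eq_sum[symmetric]) (simp add: degree_pderiv)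
  finally show ?thesis by simp
qed

lemma umbral_pairing_pderiv_funpow:
  "umbral_pairing ((pderiv ^^ k) p) F = umbral_pairing p (fps_X ^ k * F)"
  by (induction k arbitrary: F) (simp_all add: umbral_pairing_pderiv mult_ac)

lemma umbral_pairing_mult_X: "umbral_pairing ([:0, 1:] * p) F = umbral_pairing p (fps_deriv F)"
proof -
  have "umbral_pairing ([:0, 1:] * p) F
      = (\<Sum>j\<le>Suc (degree p). coeff ([:0, 1:] * p) j * fact j * fps_nth F j)"
    by (rule umbral_pairing_eq_sum) (simp add: degree_pCons_le)
  also have "\<dots> = (\<Sum>j\<le>degree p. coeff p j * fact (Suc j) * fps_nth F (Suc j))"
    by (subst sum.atMost_Suc_shift) simp
  also have "\<dots> = umbral_pairing p (fps_deriv F)"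
    by (simp add: umbral_pairing_def algebra_simps)
  finally show ?thesis .
qed

text \<open>
  Summing \<open>umbral_pairing_pderiv_funpow\<close> against the Taylor coefficients of \<open>W\<close>: only the
  coefficients up to the degree of \<open>p\<close> contribute, so the truncated sum of the monomials
  \<open>w\<^sub>k z\<^sup>k\<close> may be replaced by the whole series of \<open>W\<close>.
\<close>
lemma umbral_pairing_series_D:
  "umbral_pairing (series_D W p) F = umbral_pairing p (fps_expansion W 0 * F)"
proof -
  let ?w = "fps_nth (fps_expansion W 0)" and ?N = "degree p"
  have "umbral_pairing (series_D W p) F = (\<Sum>k\<le>?N. ?w k * umbral_pairing p (fps_X ^ k * F))"
    by (simp add: series_D_def umbral_pairing_sum_left umbral_pairing_smult_left
                  umbral_pairing_pderiv_funpow)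
  also have "\<dots> = (\<Sum>k\<le>?N. \<Sum>j\<le>?N. coeff p j * fact j * (?w k * fps_nth (fps_X ^ k * F) j))"
    by (simp add: umbral_pairing_def sum_distrib_left mult_ac)
  also have "\<dots> = (\<Sum>j\<le>?N. coeff p j * fact j * (\<Sum>k\<le>?N. ?w k * fps_nth (fps_X ^ k * F) j))"
    by (subst sum.swap) (simp add: sum_distrib_left)
  also have "\<dots> = (\<Sum>j\<le>?N. coeff p j * fact j * fps_nth (fps_expansion W 0 * F) j)"
  proof (intro sum.cong refl arg_cong2[where f = "(*)"])
    fix j assume j: "j \<in> {..?N}"
    have "(\<Sum>k\<le>?N. ?w k * fps_nth (fps_X ^ k * F) j) = (\<Sum>k\<le>j. ?w k * fps_nth F (j - k))"
      using j by (intro sum.mono_neutral_cong_right) (auto simp: fps_X_power_mult_nth)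
    then show "(\<Sum>k\<le>?N. ?w k * fps_nth (fps_X ^ k * F) j) = fps_nth (fps_expansion W 0 * F) j"
      by (simp add: fps_mult_nth atLeast0AtMost)
  qed
  finally show ?thesis
    by (simp add: umbral_pairing_def)
qed

lemma umbral_pairing_Y_op:
  "umbral_pairing (Y_op W p) F = umbral_pairing p (fps_expansion W 0 * fps_deriv F)"
  unfolding Y_op_def by (simp only: umbral_pairing_mult_X umbral_pairing_series_D)

lemma analytic_Y_tilde:
  assumes "W analytic_on {0}" "f analytic_on {0}"
  shows "Y_tilde W f analytic_on {0}"
  unfolding Y_tilde_def using assms by (intro analytic_intros)

lemma fps_expansion_Y_tilde:
  assumes "W analytic_on {0}" "f analytic_on {0}"
  shows "fps_expansion (Y_tilde W f) 0 = fps_expansion W 0 * fps_deriv (fps_expansion f 0)"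
  unfolding Y_tilde_def using assms
  by (intro fps_expansion_eqI has_fps_expansion_mult has_fps_expansion_deriv
            analytic_at_imp_has_fps_expansion_0)

text \<open>
  The adjoint acts on the outside first: the outermost \<open>Y\<close> becomes the innermost
  \<open>Y_tilde W\<close>, which is why the induction generalises over \<open>f\<close>.
\<close>
lemma umbral_pairing_Y_op_funpow:
  assumes "W analytic_on {0}" "f analytic_on {0}"
  shows "umbral_pairing ((Y_op W ^^ n) p) (fps_expansion f 0)
       = umbral_pairing p (fps_expansion ((Y_tilde W ^^ n) f) 0)"
  using assms(2)
proof (induction n arbitrary: f)
  case (Suc n)
  have "umbral_pairing ((Y_op W ^^ Suc n) p) (fps_expansion f 0)
      = umbral_pairing ((Y_op W ^^ n) p) (fps_expansion (Y_tilde W f) 0)"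
    by (simp add: umbral_pairing_Y_op fps_expansion_Y_tilde assms(1) Suc.prems)
  also have "\<dots> = umbral_pairing p (fps_expansion ((Y_tilde W ^^ n) (Y_tilde W f)) 0)"
    by (intro Suc.IH analytic_Y_tilde assms(1) Suc.prems)
  finally show ?case
    by (simp add: funpow_swap1)
qed simp

text \<open>
  The inverse function theorem in the form \<open>U' = W \<circ> U\<close>. It is applied at the points \<open>V z\<close>,
  and these fill a neighbourhood of 0 because the injective function \<open>V\<close> is open.
\<close>
lemma eventually_deriv_local_inverse:
  fixes V W U :: "complex \<Rightarrow> complex"
  assumes V: "V analytic_on {0}" "V 0 = 0" "deriv V 0 \<noteq> 0"
    and W: "\<forall>\<^sub>F z in nhds 0. W z = 1 / deriv V z"
    and U: "\<forall>\<^sub>F z in nhds 0. U (V z) = z"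
  shows "\<forall>\<^sub>F v in nhds 0. (U has_field_derivative W (U v)) (at v)"
proof -
  obtain S where S: "open S" "0 \<in> S" "V holomorphic_on S"
    using V(1) by (auto simp: analytic_at)
  have "isCont (deriv V) 0"
    using V(1) by (intro analytic_at_imp_isCont analytic_deriv)
  then have "\<forall>\<^sub>F z in nhds 0. deriv V z \<noteq> 0"
    using V(3) by (auto simp: isCont_def tendsto_at_iff_tendsto_nhds intro: tendsto_imp_eventually_ne)
  then have "\<forall>\<^sub>F z in nhds 0. deriv V z \<noteq> 0 \<and> W z = 1 / deriv V z \<and> U (V z) = z \<and> z \<in> S"
    using W U S by (intro eventually_conj eventually_nhds_in_open) auto
  then obtain T where T: "open T" "0 \<in> T"
    and T_props: "\<And>z. z \<in> T \<Longrightarrow> deriv V z \<noteq> 0 \<and> W z = 1 / deriv V z \<and> U (V z) = z \<and> z \<in> S"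
    unfolding eventually_nhds by blast
  have hol: "V holomorphic_on T"
    using S(3) T_props by (auto intro: holomorphic_on_subset)
  have "inj_on V T"
    using T_props by (metis inj_onI)
  then have "open (V ` T)"
    using hol T(1) by (intro open_mapping_thm3)
  moreover have "0 \<in> V ` T"
    using T(2) V(2) by force
  moreover have "(U has_field_derivative W (U v)) (at v)" if "v \<in> V ` T" for v
  proof -
    obtain z where z: "z \<in> T" "v = V z"
      using \<open>v \<in> V ` T\<close> by blast
    have "(U has_field_derivative inverse (deriv V z)) (at (V z))"
    proof (rule has_field_derivative_inverse_strong[where f = V and g = U and S = T])
      show "(V has_field_derivative deriv V z) (at z)"
        using hol T(1) z(1) by (intro holomorphic_derivI)
    qed (use hol T(1) T_props z(1) in \<open>auto intro: holomorphic_on_imp_continuous_on\<close>)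
    then show ?thesis
      using T_props z by (simp add: inverse_eq_divide)
  qed
  ultimately show ?thesis
    unfolding eventually_nhds by blast
qed

text \<open>
  The equation must hold near 0, and not only at 0, for the induction: the next derivative
  depends on the germ.
\<close>
lemma eventually_higher_deriv_compose_eq_Y_tilde:
  fixes f W U :: "complex \<Rightarrow> complex"
  assumes W: "W analytic_on {0}" and f: "f analytic_on {0}" and "U 0 = 0"
    and U: "\<forall>\<^sub>F v in nhds 0. (U has_field_derivative W (U v)) (at v)"
  shows "\<forall>\<^sub>F v in nhds 0. (deriv ^^ n) (\<lambda>v. f (U v)) v = (Y_tilde W ^^ n) f (U v)"
proof (induction n)
  case (Suc n)
  let ?g = "(Y_tilde W ^^ n) f"
  have g: "?g analytic_on {0}"
    by (induction n) (auto intro: analytic_Y_tilde W f)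
  have "isCont U 0"
    using eventually_nhds_x_imp_x[OF U] by (rule DERIV_isCont)
  then have "filterlim U (nhds (U 0)) (nhds 0)"
    unfolding isCont_def tendsto_at_iff_tendsto_nhds .
  then have "filterlim U (nhds 0) (nhds 0)"
    using \<open>U 0 = 0\<close> by simp
  moreover have "\<forall>\<^sub>F z in nhds 0. ?g analytic_on {z}"
    using g unfolding analytic_at eventually_nhds by blast
  ultimately have "\<forall>\<^sub>F v in nhds 0. ?g analytic_on {U v}"
    by (rule eventually_compose_filterlim[rotated])
  moreover have "\<forall>\<^sub>F v in nhds 0. \<forall>\<^sub>F u in nhds v. (deriv ^^ n) (\<lambda>v. f (U v)) u = ?g (U u)"
    using Suc.IH by (simp add: eventually_eventually)
  ultimately show ?case
    using U
  proof eventually_elim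
    case (elim v)
    have "((\<lambda>v. ?g (U v)) has_field_derivative deriv ?g (U v) * W (U v)) (at v)"
      using elim(1,3) by (intro DERIV_chain2[where g = U]) (auto intro: analytic_derivI)
    then have "deriv (\<lambda>v. ?g (U v)) v = Y_tilde W ?g (U v)"
      by (simp add: DERIV_imp_deriv Y_tilde_def mult.commute)
    moreover have "deriv ((deriv ^^ n) (\<lambda>v. f (U v))) v = deriv (\<lambda>v. ?g (U v)) v"
      by (rule deriv_cong_ev) (use elim in auto)
    ultimately show ?case
      by simp
  qed
qed simp

theorem theorem1:
  fixes V W U :: "complex \<Rightarrow> complex" and m n :: nat
  assumes "V analytic_on {0}" and "V 0 = 0" and "deriv V 0 = 1"
    and "\<forall>\<^sub>F z in nhds 0. W z = 1 / deriv V z"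
    and "\<forall>\<^sub>F v in nhds 0. V (U v) = v"
    and "\<forall>\<^sub>F z in nhds 0. U (V z) = z"
    and "U 0 = 0"
  shows "fact m * coeff ((Y_op W ^^ n) 1) m = (Y_tilde W ^^ n) (\<lambda>A. A ^ m) 0 \<and>
         (Y_tilde W ^^ n) (\<lambda>A. A ^ m) 0 = fact n * fps_nth (fps_expansion (\<lambda>v. U v ^ m) 0) n"
proof
  have "(\<lambda>z. 1 / deriv V z) analytic_on {0}"
    using assms(1,3) by (intro analytic_intros) auto
  then have W: "W analytic_on {0}"
    using analytic_at_cong[OF assms(4) refl] by simp
  have pow: "(\<lambda>A::complex. A ^ m) analytic_on {0}"
    by (intro analytic_intros)
  have "fps_expansion (\<lambda>A::complex. A ^ m) 0 = fps_X ^ m"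
    by (intro fps_expansion_eqI has_fps_expansion_fps_X_power)
  then have "fact m * coeff ((Y_op W ^^ n) 1) m
      = umbral_pairing ((Y_op W ^^ n) 1) (fps_expansion (\<lambda>A. A ^ m) 0)"
    by (simp add: umbral_pairing_fps_X_power)
  also have "\<dots> = (Y_tilde W ^^ n) (\<lambda>A. A ^ m) 0"
    by (subst umbral_pairing_Y_op_funpow[OF W pow])
       (simp add: umbral_pairing_1_left fps_expansion_def)
  finally show "fact m * coeff ((Y_op W ^^ n) 1) m = (Y_tilde W ^^ n) (\<lambda>A. A ^ m) 0" .

  have "\<forall>\<^sub>F v in nhds 0. (U has_field_derivative W (U v)) (at v)"
    using assms by (intro eventually_deriv_local_inverse[of V]) auto
  then have "\<forall>\<^sub>F v in nhds 0. (deriv ^^ n) (\<lambda>v. U v ^ m) v = (Y_tilde W ^^ n) (\<lambda>A. A ^ m) (U v)"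
    by (rule eventually_higher_deriv_compose_eq_Y_tilde[where U = U, OF W pow assms(7)])
  then have "(deriv ^^ n) (\<lambda>v. U v ^ m) 0 = (Y_tilde W ^^ n) (\<lambda>A. A ^ m) 0"
    using eventually_nhds_x_imp_x assms(7) by force
  then show "(Y_tilde W ^^ n) (\<lambda>A. A ^ m) 0
      = fact n * fps_nth (fps_expansion (\<lambda>v. U v ^ m) 0) n"
    by (simp add: fps_expansion_def)
qed

end
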